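(* Let $\rho$ be a $C^2$ function of $x$ such that $\Gamma=\{\rho(x)X : X=(x,x_{n+1})\in\mathscr U\}$ is a solution of the near field refractor problem (as in the context) satisfying the conditions: $y_{n+1}>0$; $\psi^{n+1}>0$; $\nabla\psi(Z(x))\cdot Y(x)>0$; $\operatorname{dist}(\mathscr U,\mathscr V)>0$. Let $\mathcal M,\mathcal A,\mathcal B$ be the matrices given in the context, for which $\det(\mathcal M)\det\left(D^2\rho+\frac1{bt}\mathcal A+\frac1b\mathcal B\right)=\frac fg\frac{y_{n+1}}{x_{n+1}}\frac{\nabla\psi\cdot Y}{|\nabla\psi|}\frac1{t^n}$. Then at $x=0$ $$\mathcal A(0,\rho,\nabla\rho)=\rho\,\mathrm{Id}-\frac{\kappa^2-1}{\rho}\nabla\rho\otimes\nabla\rho,\qquad \mathcal B(0,\rho,\nabla\rho)=(\kappa-b\rho)\,\mathrm{Id}-\frac{2b}{\rho}\nabla\rho\otimes\nabla\rho.$$ Therefore the equation becomes at $x=0$ $$\det\left(D^2\rho+\frac1{bt}\Big(\rho\,\mathrm{Id}-\frac{\kappa^2-1}\rho\nabla\rho\otimes\nabla\rho\Big)+\frac{\kappa-b\rho}{b}\mathrm{Id}-\frac2\rho\nabla\rho\otimes\nabla\rho\right)=\frac{f}{g\,\det(\mathcal M)}\,\frac{\nabla\psi\cdot Y}{|\nabla\psi|}\,\frac{1}{t^n}\,y_{n+1}.$$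
   Context: Setting. $n\ge2$; $\mathbb S^n_+=\{X=(x,x_{n+1})\in\mathbb R^{n+1}:|X|=1,\ x_{n+1}>0\}$, with $x\in\mathbb R^n$, $x_{n+1}=\sqrt{1-|x|^2}$. $\mathscr U\subset\mathbb S^n_+$ is open; $\Sigma=\{\psi=0\}\subset\mathbb R^{n+1}$ is a regular hypersurface, $\psi$ smooth; $\mathscr V$ is an open subset of $\Sigma$. $\nabla\psi=(\psi^1,\dots,\psi^{n+1})=(\widehat\nabla\psi,\psi^{n+1})$ with $\psi^k=\partial\psi/\partial z_k$, evaluated at $Z(x)$. $f\in L^1(\mathscr U)$, $g\in L^1(\mathscr V)$ are positive smooth functions with $\int_{\mathscr U}f\,d\sigma=\int_{\mathscr V}g\,d\sigma$ ($d\sigma$ = surface measure on $\mathbb S^n$, resp. $\Sigma$); $f$ is evaluated at $X$ and $g$ at $Z(x)$. $\rho>0$, and $\Gamma$ separates two homogeneous media with refractive indices $n_1$ (containing the origin) and $n_2$; $\kappa=n_1/n_2\neq1$ ($n_1$ may be smaller or larger than $n_2$). Refraction. $\nabla\rho$, $D^2\rho$ are derivatives in $x\in\mathbb R^n$. The unit normal to $\Gamma$ at $\rho(x)X$ toward medium $n_2$ is $\nu=-\frac{(\nabla\rho,0)-X(\rho+x\cdot\nabla\rho)}{\sqrt{\rho^2+|\nabla\rho|^2-(x\cdot\nabla\rho)^2}}$. A ray from the origin in direction $X$ is refracted at $\rho(x)X$ into the unit direction $Y(x)=(y,y_{n+1})$, $y\in\mathbb R^n$, given by Snell's law $X-\frac1\kappa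 Y=\lambda\nu$, $\lambda=X\cdot\nu-\frac1\kappa\sqrt{1-\kappa^2(1-(X\cdot\nu)^2)}$. The refracted ray hits $\Sigma$ at $Z(x)=\rho(x)X+t(x)Y(x)$, where $t(x)=|Z(x)-\rho(x)X|$ (the stretch function). $\Gamma$ solves the near field refractor problem if $Z(x)\in\mathscr V$ for all $X\in\mathscr U$ and $\int_Ef\,d\sigma=\int_{\mathcal R(E)}g\,d\sigma$ for all Borel $E\subset\mathscr U$, where $\mathcal R(E)=\{Z(x):(x,x_{n+1})\in E\}$. Notation. Vectors are columns, $\xi\otimes\eta=\xi\eta^t$, $\mathrm{Id}$ is the $n\times n$ identity. $a=\rho^2+|\nabla\rho|^2-(\nabla\rho\cdot x)^2$, $q=\sqrt{a-\kappa^2(a-\rho^2)}$, $b=\frac{\kappa\rho-q}{a}$, $\alpha=-\frac{b^2}{\kappa^2-1}\cdot\frac{\kappa q+\rho+(\kappa^2-1)x\cdot\nabla\rho}{q}$, $\beta=\frac{b^2}q$. $$\mathcal M=b(\mathrm{Id}-x\otimes x)+\beta[\nabla\rho-(\rho+x\cdot\nabla\rho)x]\otimes[\nabla\rho-(x\cdot\nabla\rho)x]$$ (invertible near $x=0$), $$\mu_0=\mu_2^{-1}\mu_1=\rho\,\mathrm{Id}+x\otimes\nabla\rho+y\otimes\big[\rho x-\rho y-(X\cdot Y)\nabla\rho\big],$$ where $$\mu_1=\rho\,\mathrm{Id}+x\otimes\nabla\rho-\frac1{\nabla\psi\cdot Y}\Big(\rho\,y\otimes\widehat\nabla\psi-\frac{\rho\,\psi^{n+1}}{x_{n+1}}y\otimes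 x+(\nabla\psi\cdot X)\,y\otimes\nabla\rho\Big),$$ $$\mu_2=\mathrm{Id}-\frac1{\nabla\psi\cdot Y}\,y\otimes\Big(\widehat\nabla\psi-\frac{\psi^{n+1}}{y_{n+1}}y\Big),$$ and $$\mathcal A=b\,\mathcal M^{-1}\mu_0,\qquad \mathcal B=b\,\mathcal M^{-1}\Big\{(\kappa-b(\rho+x\cdot\nabla\rho))\mathrm{Id}+\big[\alpha(\nabla\rho-(\rho+x\cdot\nabla\rho)x)-2bx\big]\otimes\nabla\rho\Big\}.$$ *)

theory Defs
  imports "HOL-Analysis.Analysis"
begin

section \<open>Smooth functions and gradients\<close>

(* Meaningful for open S.  In finite dimension this is continuity of all iterated directional,
   hence of all partial, derivatives up to order k. *)
primrec Ck_on :: "nat \<Rightarrow> 'a::real_normed_vector set \<Rightarrow> ('a \<Rightarrow> 'b::real_normed_vector) \<Rightarrow> bool" where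
  "Ck_on 0 S f \<longleftrightarrow> continuous_on S f"
| "Ck_on (Suc k) S f \<longleftrightarrow>
     (\<forall>x\<in>S. f differentiable (at x)) \<and>
     (\<forall>v. Ck_on k S (\<lambda>x. frechet_derivative f (at x) v))"

(* S is an arbitrary set, typically a piece of a hypersurface: f is locally the restriction of a
   smooth function on an open subset of the ambient space. *)
definition smooth_on :: "'a::real_normed_vector set \<Rightarrow> ('a \<Rightarrow> 'b::real_normed_vector) \<Rightarrow> bool" where
  "smooth_on S f \<longleftrightarrow>
     (\<forall>p\<in>S. \<exists>W F. open W \<and> p \<in> W \<and> (\<forall>k. Ck_on k W F) \<and> (\<forall>z\<in>W \<inter> S. F z = f z))"

definition grad :: "('a::euclidean_space \<Rightarrow> real) \<Rightarrow> 'a \<Rightarrow> 'a" where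
  "grad f x = (\<Sum>e\<in>Basis. frechet_derivative f (at x) e *\<^sub>R e)"

definition hessian :: "(real^'n \<Rightarrow> real) \<Rightarrow> real^'n \<Rightarrow> real^'n^'n" where
  "hessian f x = jacobian (grad f) (at x)"

definition outer :: "real^'n \<Rightarrow> real^'n \<Rightarrow> real^'n^'n" (infixl \<open>\<otimes>\<close> 75) where
  "\<xi> \<otimes> \<eta> = (\<chi> i j. \<xi> $ i * \<eta> $ j)"


section \<open>Surface measure\<close>

definition hausdorff_content :: "nat \<Rightarrow> real \<Rightarrow> 'a::metric_space set \<Rightarrow> ennreal" where
  "hausdorff_content k \<delta> E =
     (INF C \<in> {C :: nat \<Rightarrow> 'a set. E \<subseteq> (\<Union>i. C i) \<and> (\<forall>i. bounded (C i) \<and> diameter (C i) \<le> \<delta>)}.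
        \<Sum>i. ennreal (unit_ball_vol (real k) * (diameter (C i) / 2) ^ k))"

definition hausdorff_outer :: "nat \<Rightarrow> 'a::metric_space set \<Rightarrow> ennreal" where
  "hausdorff_outer k E = (SUP \<delta>\<in>{0<..}. hausdorff_content k \<delta> E)"

(* The sigma-algebra consists of the Caratheodory-measurable sets.  It contains the Borel sets and,
   being closed under the Souslin operation, also the continuous images of Borel sets, so that the
   integrals over such images below are the intended ones. *)
definition hausdorff_measure :: "nat \<Rightarrow> 'a::metric_space measure" where
  "hausdorff_measure k =
     measure_of UNIV (lambda_system UNIV (Pow UNIV) (hausdorff_outer k)) (hausdorff_outer k)"

(* The space R^(n+1) is represented as (real^'n) \<times> real, with Z = (z, z_(n+1)).  With the above
   normalization, the n-dimensional Hausdorff measure is the usual area on every hypersurface. *)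
definition surface_measure :: "((real^'n::finite) \<times> real) measure" where
  "surface_measure = hausdorff_measure CARD('n)"


section \<open>The refractor problem\<close>

definition upper_hemisphere :: "((real^'n) \<times> real) set" where
  "upper_hemisphere = {X. norm X = 1 \<and> 0 < snd X}"

definition hemi :: "real^'n \<Rightarrow> (real^'n) \<times> real" where
  "hemi x = (x, sqrt (1 - (norm x)\<^sup>2))"

definition chart :: "((real^'n) \<times> real) set \<Rightarrow> (real^'n) set" where
  "chart E = {x. norm x < 1 \<and> hemi x \<in> E}"

text \<open>In what follows \<open>\<kappa>\<close> is the quotient of the refractive indices, and \<open>r\<close>, \<open>p\<close> and \<open>G\<close> stand for
  \<open>\<rho>(x)\<close>, \<open>\<nabla>\<rho>(x)\<close> and \<open>\<nabla>\<psi>(Z(x))\<close>.\<close>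

definition coef_a :: "real^'n \<Rightarrow> real \<Rightarrow> real^'n \<Rightarrow> real" where
  "coef_a x r p = r\<^sup>2 + (norm p)\<^sup>2 - (p \<bullet> x)\<^sup>2"

definition unit_normal :: "real^'n \<Rightarrow> real \<Rightarrow> real^'n \<Rightarrow> (real^'n) \<times> real" where
  "unit_normal x r p =
     - ((1 / sqrt (coef_a x r p)) *\<^sub>R ((p, 0) - (r + x \<bullet> p) *\<^sub>R hemi x))"

definition snell_lambda :: "real \<Rightarrow> real^'n \<Rightarrow> real \<Rightarrow> real^'n \<Rightarrow> real" where
  "snell_lambda \<kappa> x r p =
     (let c = hemi x \<bullet> unit_normal x r p in c - (1 / \<kappa>) * sqrt (1 - \<kappa>\<^sup>2 * (1 - c\<^sup>2)))"

(* Snell's law X - Y / \<kappa> = \<lambda> \<nu>, solved for Y. *)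
definition refracted :: "real \<Rightarrow> real^'n \<Rightarrow> real \<Rightarrow> real^'n \<Rightarrow> (real^'n) \<times> real" where
  "refracted \<kappa> x r p = \<kappa> *\<^sub>R (hemi x - snell_lambda \<kappa> x r p *\<^sub>R unit_normal x r p)"

(* No total internal reflection, critical angle excluded (there q = 0 and \<alpha>, \<beta> are undefined).
   Needed explicitly since sqrt is a total function; automatic when \<kappa> < 1. *)
definition transmitted :: "real \<Rightarrow> real^'n \<Rightarrow> real \<Rightarrow> real^'n \<Rightarrow> bool" where
  "transmitted \<kappa> x r p \<longleftrightarrow> \<kappa>\<^sup>2 * (1 - (hemi x \<bullet> unit_normal x r p)\<^sup>2) < 1"

definition stretch :: "(real^'n \<Rightarrow> real) \<Rightarrow> (real^'n \<Rightarrow> (real^'n) \<times> real) \<Rightarrow> real^'n \<Rightarrow> real" where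
  "stretch \<rho> Z x = norm (Z x - \<rho> x *\<^sub>R hemi x)"

definition refractor_data ::
    "((real^'n) \<times> real \<Rightarrow> real) \<Rightarrow> ((real^'n) \<times> real) set \<Rightarrow> ((real^'n) \<times> real) set \<Rightarrow>
     ((real^'n) \<times> real \<Rightarrow> real) \<Rightarrow> ((real^'n) \<times> real \<Rightarrow> real) \<Rightarrow> bool" where
  "refractor_data \<psi> \<U> \<V> f g \<longleftrightarrow>
     openin (top_of_set upper_hemisphere) \<U> \<and>
     smooth_on UNIV \<psi> \<and> (\<forall>z. \<psi> z = 0 \<longrightarrow> grad \<psi> z \<noteq> 0) \<and>
     openin (top_of_set {z. \<psi> z = 0}) \<V> \<and>
     (\<forall>X\<in>\<U>. 0 < f X) \<and> smooth_on \<U> f \<and> set_integrable surface_measure \<U> f \<and>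
     (\<forall>z\<in>\<V>. 0 < g z) \<and> smooth_on \<V> g \<and> set_integrable surface_measure \<V> g \<and>
     set_lebesgue_integral surface_measure \<U> f = set_lebesgue_integral surface_measure \<V> g"

(* Z x is a point in which the ray refracted at \<rho>(x) X hits the receiver; it lies on {\<psi> = 0}
   because \<V> is contained in that set. *)
definition near_field_refractor ::
    "real \<Rightarrow> ((real^'n) \<times> real) set \<Rightarrow> ((real^'n) \<times> real) set \<Rightarrow>
     ((real^'n) \<times> real \<Rightarrow> real) \<Rightarrow> ((real^'n) \<times> real \<Rightarrow> real) \<Rightarrow>
     (real^'n \<Rightarrow> real) \<Rightarrow> (real^'n \<Rightarrow> (real^'n) \<times> real) \<Rightarrow> bool" where
  "near_field_refractor \<kappa> \<U> \<V> f g \<rho> Z \<longleftrightarrow>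
     (\<forall>x\<in>chart \<U>.
        0 < \<rho> x \<and> transmitted \<kappa> x (\<rho> x) (grad \<rho> x) \<and>
        Z x = \<rho> x *\<^sub>R hemi x + stretch \<rho> Z x *\<^sub>R refracted \<kappa> x (\<rho> x) (grad \<rho> x) \<and>
        Z x \<in> \<V>) \<and>
     (\<forall>E\<in>sets borel. E \<subseteq> \<U> \<longrightarrow>
        set_lebesgue_integral surface_measure E f =
        set_lebesgue_integral surface_measure (Z ` chart E) g)"


section \<open>The coefficient matrices\<close>

definition coef_q :: "real \<Rightarrow> real^'n \<Rightarrow> real \<Rightarrow> real^'n \<Rightarrow> real" where
  "coef_q \<kappa> x r p = sqrt (coef_a x r p - \<kappa>\<^sup>2 * (coef_a x r p - r\<^sup>2))"

definition coef_b :: "real \<Rightarrow> real^'n \<Rightarrow> real \<Rightarrow> real^'n \<Rightarrow> real" where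
  "coef_b \<kappa> x r p = (\<kappa> * r - coef_q \<kappa> x r p) / coef_a x r p"

definition coef_alpha :: "real \<Rightarrow> real^'n \<Rightarrow> real \<Rightarrow> real^'n \<Rightarrow> real" where
  "coef_alpha \<kappa> x r p =
     - ((coef_b \<kappa> x r p)\<^sup>2 / (\<kappa>\<^sup>2 - 1)) *
       ((\<kappa> * coef_q \<kappa> x r p + r + (\<kappa>\<^sup>2 - 1) * (x \<bullet> p)) / coef_q \<kappa> x r p)"

definition coef_beta :: "real \<Rightarrow> real^'n \<Rightarrow> real \<Rightarrow> real^'n \<Rightarrow> real" where
  "coef_beta \<kappa> x r p = (coef_b \<kappa> x r p)\<^sup>2 / coef_q \<kappa> x r p"

definition mat_M :: "real \<Rightarrow> real^'n \<Rightarrow> real \<Rightarrow> real^'n \<Rightarrow> real^'n^'n" where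
  "mat_M \<kappa> x r p =
     coef_b \<kappa> x r p *\<^sub>R (mat 1 - x \<otimes> x) +
     coef_beta \<kappa> x r p *\<^sub>R ((p - (r + x \<bullet> p) *\<^sub>R x) \<otimes> (p - (x \<bullet> p) *\<^sub>R x))"

definition mat_mu1 ::
    "real \<Rightarrow> real^'n \<Rightarrow> real \<Rightarrow> real^'n \<Rightarrow> (real^'n) \<times> real \<Rightarrow> real^'n^'n" where
  "mat_mu1 \<kappa> x r p G =
     (let X = hemi x; Y = refracted \<kappa> x r p; y = fst Y in
        r *\<^sub>R mat 1 + x \<otimes> p -
        (1 / (G \<bullet> Y)) *\<^sub>R
          (r *\<^sub>R (y \<otimes> fst G) - (r * snd G / snd X) *\<^sub>R (y \<otimes> x) + (G \<bullet> X) *\<^sub>R (y \<otimes> p)))"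

definition mat_mu2 ::
    "real \<Rightarrow> real^'n \<Rightarrow> real \<Rightarrow> real^'n \<Rightarrow> (real^'n) \<times> real \<Rightarrow> real^'n^'n" where
  "mat_mu2 \<kappa> x r p G =
     (let Y = refracted \<kappa> x r p; y = fst Y in
        mat 1 - (1 / (G \<bullet> Y)) *\<^sub>R (y \<otimes> (fst G - (snd G / snd Y) *\<^sub>R y)))"

(* Multiplying out, this equals
     r Id + x \<otimes> p + y \<otimes> [r (y_(n+1) / x_(n+1)) x - r y - (X \<bullet> Y) p];
   the factor y_(n+1) / x_(n+1) is missing in the expanded form found in the literature, which is
   hence equal to this matrix only where the term with r x vanishes or that factor is 1; in
   particular the two agree at x = 0. *)
definition mat_mu0 ::
    "real \<Rightarrow> real^'n \<Rightarrow> real \<Rightarrow> real^'n \<Rightarrow> (real^'n) \<times> real \<Rightarrow> real^'n^'n" where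
  "mat_mu0 \<kappa> x r p G = matrix_inv (mat_mu2 \<kappa> x r p G) ** mat_mu1 \<kappa> x r p G"

definition mat_A ::
    "real \<Rightarrow> real^'n \<Rightarrow> real \<Rightarrow> real^'n \<Rightarrow> (real^'n) \<times> real \<Rightarrow> real^'n^'n" where
  "mat_A \<kappa> x r p G = coef_b \<kappa> x r p *\<^sub>R (matrix_inv (mat_M \<kappa> x r p) ** mat_mu0 \<kappa> x r p G)"

definition mat_B :: "real \<Rightarrow> real^'n \<Rightarrow> real \<Rightarrow> real^'n \<Rightarrow> real^'n^'n" where
  "mat_B \<kappa> x r p =
     (let b = coef_b \<kappa> x r p; \<alpha> = coef_alpha \<kappa> x r p in
        b *\<^sub>R (matrix_inv (mat_M \<kappa> x r p) **
          ((\<kappa> - b * (r + x \<bullet> p)) *\<^sub>R mat 1 +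
           (\<alpha> *\<^sub>R (p - (r + x \<bullet> p) *\<^sub>R x) - (2 * b) *\<^sub>R x) \<otimes> p)))"

(* Left- and right-hand sides are evaluated at the point x. *)
definition refractor_equation ::
    "real \<Rightarrow> ((real^'n) \<times> real \<Rightarrow> real) \<Rightarrow>
     ((real^'n) \<times> real \<Rightarrow> real) \<Rightarrow> ((real^'n) \<times> real \<Rightarrow> real) \<Rightarrow>
     (real^'n \<Rightarrow> real) \<Rightarrow> (real^'n \<Rightarrow> (real^'n) \<times> real) \<Rightarrow> real^'n \<Rightarrow> bool" where
  "refractor_equation \<kappa> \<psi> f g \<rho> Z x \<longleftrightarrow>
     (let r = \<rho> x; p = grad \<rho> x; G = grad \<psi> (Z x); t = stretch \<rho> Z x;
          X = hemi x; Y = refracted \<kappa> x r p; b = coef_b \<kappa> x r p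
      in det (mat_M \<kappa> x r p) *
         det (hessian \<rho> x + (1 / (b * t)) *\<^sub>R mat_A \<kappa> x r p G + (1 / b) *\<^sub>R mat_B \<kappa> x r p) =
         f X / g (Z x) * (snd Y / snd X) * ((G \<bullet> Y) / norm G) * (1 / t ^ CARD('n)))"

end

theory Submission
  imports Defs
begin

text \<open>
  At \<open>x = 0\<close> Snell's law gives \<open>Y = (b p, \<kappa> - b r)\<close>, so all matrices involved are combinations of the
  identity and rank-one matrices with left factor \<open>p\<close>. Since \<open>\<M>\<close> and \<open>\<mu>\<^sub>2\<close> are invertible, the
  claimed values of \<open>\<mu>\<^sub>0\<close>, \<open>\<A>\<close> and \<open>\<B>\<close> need only be multiplied by \<open>\<mu>\<^sub>2\<close> or \<open>\<M>\<close>, and the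
  resulting scalar identities follow from \<open>q\<^sup>2 = r\<^sup>2 + |p|\<^sup>2 - \<kappa>\<^sup>2 |p|\<^sup>2\<close> and
  \<open>a b = \<kappa> r - q\<close>.
\<close>

section \<open>Algebra of rank-one perturbations of the identity\<close>

lemma outer_nth [simp]: "(u \<otimes> v) $ i $ j = u $ i * v $ j"
  by (simp add: outer_def)

lemma outer_simps [simp]:
  "0 \<otimes> v = 0" "v \<otimes> 0 = 0"
  "(- u) \<otimes> v = - (u \<otimes> v)"
  "(c *\<^sub>R u) \<otimes> v = c *\<^sub>R (u \<otimes> v)" "u \<otimes> (c *\<^sub>R v) = c *\<^sub>R (u \<otimes> v)"
  by (simp_all add: vec_eq_iff)

lemma outer_diff_right: "u \<otimes> (v - w) = u \<otimes> v - u \<otimes> w"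
  by (simp add: vec_eq_iff algebra_simps)

lemma outer_mult_outer: "(u \<otimes> v) ** (w \<otimes> z) = (v \<bullet> w) *\<^sub>R (u \<otimes> z)"
  by (simp add: vec_eq_iff matrix_matrix_mult_def inner_vec_def sum_distrib_left
      sum_distrib_right mult_ac)

lemma matrix_add_rdistrib: "(A + B) ** C = A ** C + B ** C"
  for A B :: "real^'n^'m" and C :: "real^'k^'n"
  by (simp add: vec_eq_iff matrix_matrix_mult_def sum.distrib distrib_right)

lemma matrix_mult_scaleR_right: "A ** (c *\<^sub>R B) = c *\<^sub>R (A ** B)"
  for A :: "real^'n^'m"
  by (simp add: matrix_scalar_ac scalar_matrix_assoc)

lemma rank_one_mult:
  "(c *\<^sub>R mat 1 + u \<otimes> v) ** (d *\<^sub>R mat 1 + w \<otimes> z)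
    = (c * d) *\<^sub>R mat 1 + d *\<^sub>R (u \<otimes> v) + c *\<^sub>R (w \<otimes> z) + (v \<bullet> w) *\<^sub>R (u \<otimes> z)"
  by (simp add: matrix_add_ldistrib matrix_add_rdistrib scalar_matrix_assoc[symmetric]
      matrix_mult_scaleR_right outer_mult_outer scaleR_add_right mult.commute)

text \<open>The inverse is given by the Sherman--Morrison formula.\<close>
lemma invertible_rank_one:
  fixes u v :: "real^'n"
  assumes "c \<noteq> 0" "c + u \<bullet> v \<noteq> 0"
  shows "invertible (c *\<^sub>R mat 1 + u \<otimes> v)"
proof -
  define k where "k = - 1 / (c * (c + u \<bullet> v))"
  have k: "1 / c + c * k + (v \<bullet> u) * k = 0"
    using assms by (simp add: k_def inner_commute divide_simps)
  have "(c *\<^sub>R mat 1 + u \<otimes> v) ** ((1 / c) *\<^sub>R mat 1 + (k *\<^sub>R u) \<otimes> v)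
      = mat 1 + (1 / c + c * k + (v \<bullet> u) * k) *\<^sub>R (u \<otimes> v)"
    unfolding rank_one_mult using assms by (simp add: algebra_simps)
  then have "(c *\<^sub>R mat 1 + u \<otimes> v) ** ((1 / c) *\<^sub>R mat 1 + (k *\<^sub>R u) \<otimes> v) = mat 1"
    by (simp add: k)
  then show ?thesis
    using invertible_right_inverse by blast
qed

text \<open>Reduces every evaluation of an inverse times a matrix to checking one product with the
  guessed value \<open>T\<close>.\<close>

lemma matrix_inv_mult_eqI:
  fixes A :: "real^'n^'n"
  assumes "invertible A" "A ** T = N"
  shows "matrix_inv A ** N = T"
proof -
  have "matrix_inv A ** A = mat 1"
    using assms(1) unfolding invertible_def matrix_inv_def by (rule someI2_ex) simp
  then show ?thesis
    using assms(2) by (metis matrix_mul_assoc matrix_mul_lid)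
qed

section \<open>Scalar coefficients and refracted direction at the origin\<close>

locale origin_coefficients =
  fixes \<kappa> r :: real and p :: "real^'n"
  assumes kappa: "0 < \<kappa>" "\<kappa> \<noteq> 1"
    and r: "0 < r"
    and transmitted: "transmitted \<kappa> 0 r p"
begin

definition s where "s = p \<bullet> p"
definition a where "a = coef_a 0 r p"
definition q where "q = coef_q \<kappa> 0 r p"
definition b where "b = coef_b \<kappa> 0 r p"
definition \<alpha> where "\<alpha> = coef_alpha \<kappa> 0 r p"

lemma hemi_0: "hemi (0::real^'n) = (0, 1)"
  by (simp add: hemi_def)

lemma a_eq: "a = r\<^sup>2 + s"
  by (simp add: a_def s_def coef_a_def power2_norm_eq_inner)

lemma s_nonneg: "0 \<le> s"
  by (simp add: s_def)

lemma a_pos: "0 < a"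
  using r s_nonneg by (simp add: a_eq add_pos_nonneg)

lemma unit_normal_0: "unit_normal 0 r p = (1 / sqrt a) *\<^sub>R (- p, r)"
  by (simp add: unit_normal_def hemi_0 a_def)

lemma discriminant: "1 - \<kappa>\<^sup>2 * (1 - (r / sqrt a)\<^sup>2) = (a - \<kappa>\<^sup>2 * s) / a"
  using a_pos by (simp add: power_divide divide_simps) (simp add: a_eq algebra_simps)

lemma q_eq: "q = sqrt (a - \<kappa>\<^sup>2 * s)"
  by (simp add: q_def coef_q_def flip: a_def) (simp add: a_eq)

text \<open>By \<open>discriminant\<close>, strict transmission is positivity of the radicand of
  \<open>q\<close> divided by \<open>a\<close>; the critical angle is excluded, so \<open>q\<close>
  may be divided by.\<close>

lemma radicand_pos: "0 < a - \<kappa>\<^sup>2 * s"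
proof -
  have "0 < 1 - \<kappa>\<^sup>2 * (1 - (r / sqrt a)\<^sup>2)"
    using transmitted by (simp add: transmitted_def hemi_0 unit_normal_0)
  then show ?thesis
    unfolding discriminant using a_pos by (simp add: zero_less_divide_iff)
qed

lemma q_pos: "0 < q"
  using radicand_pos by (simp add: q_eq)

lemma q_sq: "q\<^sup>2 = r\<^sup>2 + s - \<kappa>\<^sup>2 * s"
  using radicand_pos by (simp add: q_eq) (simp add: a_eq)

lemma ab: "b * (r\<^sup>2 + s) = \<kappa> * r - q"
  using a_pos by (simp add: b_def coef_b_def flip: a_def q_def a_eq)

lemma kappa_sq: "\<kappa>\<^sup>2 \<noteq> 1"
  using kappa by (simp add: power2_eq_1_iff)

text \<open>Vanishing \<open>b\<close> would mean \<open>q = \<kappa> * r\<close>; comparing squares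
  then forces \<open>\<kappa>\<^sup>2 = 1\<close>.\<close>

lemma b_nonzero: "b \<noteq> 0"
proof
  assume "b = 0"
  then have "q = \<kappa> * r"
    using ab by simp
  then have "(\<kappa>\<^sup>2 - 1) * a = 0"
    using q_sq by (simp add: a_eq power_mult_distrib algebra_simps)
  then show False
    using kappa_sq a_pos by simp
qed

text \<open>Two readings of one quantity: \<open>b / q\<close> times it is the eigenvalue of
  \<open>mat_M\<close> on a nonzero \<open>p\<close>, and divided by \<open>r\<close> it is the last
  component of the refracted direction.\<close>

lemma q_plus: "q + b * s = r * (\<kappa> - b * r)"
  using ab by (simp add: algebra_simps power2_eq_square)

lemma q_plus_pos: "0 < q + b * s"
proof -
  have "(q + b * s) * a = r * (q * r + \<kappa> * s)"
  proof -
    have "(q + b * s) * a = q * a + s * (b * (r\<^sup>2 + s))"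
      by (simp add: a_eq algebra_simps)
    also have "\<dots> = r * (q * r + \<kappa> * s)"
      unfolding ab by (simp add: a_eq algebra_simps power2_eq_square)
    finally show ?thesis .
  qed
  moreover have "0 < r * (q * r + \<kappa> * s)"
    using r q_pos kappa s_nonneg by (simp add: add_pos_nonneg)
  ultimately show ?thesis
    using a_pos by (metis zero_less_mult_pos2)
qed

text \<open>Multiplying by \<open>a\<close> turns each \<open>b\<close> into
  \<open>\<kappa> * r - q\<close>, leaving a polynomial identity modulo \<open>q_sq\<close>. It
  produces the coefficient of \<open>p \<otimes> p\<close> in \<open>mat_A\<close> and simplifies
  \<open>\<alpha>\<close> in \<open>mat_B\<close>.\<close>

lemma key_identity: "b * (\<kappa> * q + r) * r = (\<kappa>\<^sup>2 - 1) * (q + b * s)"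
proof -
  have "a * (b * (\<kappa> * q + r) * r) = (b * (r\<^sup>2 + s)) * (\<kappa> * q + r) * r"
    by (simp add: a_eq)
  also have "\<dots> = (\<kappa>\<^sup>2 - 1) * (q * a + s * (b * (r\<^sup>2 + s)))"
    unfolding ab a_eq using q_sq by algebra
  also have "\<dots> = a * ((\<kappa>\<^sup>2 - 1) * (q + b * s))"
    by (simp add: a_eq algebra_simps)
  finally show ?thesis
    using a_pos by simp
qed

text \<open>The normal is \<open>(- p, r)\<close> divided by \<open>sqrt a\<close>, so only the
  factor \<open>\<kappa> * \<lambda> / sqrt a\<close> matters, where \<lambda> is the Snell
  coefficient; it equals \<open>b\<close>.\<close>

lemma refracted_0: "refracted \<kappa> 0 r p = (b *\<^sub>R p, \<kappa> - b * r)"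
proof -
  have "snell_lambda \<kappa> 0 r p = r / sqrt a - (1 / \<kappa>) * sqrt (1 - \<kappa>\<^sup>2 * (1 - (r / sqrt a)\<^sup>2))"
    by (simp add: snell_lambda_def Let_def hemi_0 unit_normal_0)
  also have "\<dots> = r / sqrt a - (1 / \<kappa>) * (q / sqrt a)"
    unfolding discriminant by (simp only: real_sqrt_divide q_eq)
  also have "\<dots> = (\<kappa> * r - q) / (\<kappa> * sqrt a)"
    using kappa a_pos by (simp add: divide_simps)
  finally have "\<kappa> * snell_lambda \<kappa> 0 r p / sqrt a = (\<kappa> * r - q) / (sqrt a * sqrt a)"
    using kappa by simp
  then have b: "\<kappa> * snell_lambda \<kappa> 0 r p / sqrt a = b"
    using a_pos by (simp add: b_def coef_b_def flip: a_def q_def)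
  then have "\<kappa> * (snell_lambda \<kappa> 0 r p * (r / sqrt a)) = b * r"
    by (simp add: mult.assoc flip: b)
  with b show ?thesis
    by (simp add: refracted_def hemi_0 unit_normal_0 right_diff_distrib)
qed

text \<open>This is |Y| = 1 written in the components from \<open>refracted_0\<close>; it later
  eliminates \<open>b\<^sup>2 * s\<close>.\<close>

lemma refracted_unit: "b\<^sup>2 * s + (\<kappa> - b * r)\<^sup>2 = 1"
proof -
  have "a * (b\<^sup>2 * s + (\<kappa> - b * r)\<^sup>2)
      = (b * (r\<^sup>2 + s))\<^sup>2 - 2 * \<kappa> * r * (b * (r\<^sup>2 + s)) + \<kappa>\<^sup>2 * (r\<^sup>2 + s)"
    by (simp add: a_eq power2_eq_square algebra_simps)
  also have "\<dots> = a * 1"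
    unfolding ab a_eq using q_sq by algebra
  finally show ?thesis
    using a_pos by simp
qed

section \<open>Values of the matrices at the origin\<close>

lemma mat_M_0: "mat_M \<kappa> 0 r p = b *\<^sub>R mat 1 + ((b\<^sup>2 / q) *\<^sub>R p) \<otimes> p"
  by (simp add: mat_M_def coef_beta_def b_def q_def)

lemma invertible_mat_M: "invertible (mat_M \<kappa> 0 r p)"
proof -
  have "b + ((b\<^sup>2 / q) *\<^sub>R p) \<bullet> p = b * (q + b * s) / q"
    using q_pos by (simp add: s_def field_simps power2_eq_square)
  also have "\<dots> \<noteq> 0"
    using b_nonzero q_pos q_plus_pos by simp
  finally show ?thesis
    unfolding mat_M_0 using b_nonzero by (intro invertible_rank_one)
qed

context
  fixes G :: "(real^'n) \<times> real"
  assumes G_up: "0 < snd G"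
    and G_transversal: "0 < G \<bullet> refracted \<kappa> 0 r p"
    and Y_up: "0 < snd (refracted \<kappa> 0 r p)"
begin

text \<open>The value comes from the expanded form of \<mu>0: with y = b p and X \<bullet> Y =
  \<kappa> - b r, the bracket - r y - (X \<bullet> Y) p collapses to - \<kappa> p.\<close>

lemma mat_mu0_0: "mat_mu0 \<kappa> 0 r p G = r *\<^sub>R mat 1 - (b * \<kappa>) *\<^sub>R (p \<otimes> p)"
proof -
  define d where "d = G \<bullet> refracted \<kappa> 0 r p"
  define w where "w = \<kappa> - b * r"
  \<comment> \<open>The right factor of the rank-one part of \<open>mat_mu2\<close>.\<close>
  define h where "h = fst G - (snd G / w) *\<^sub>R (b *\<^sub>R p)"
  have d: "0 < d" and w: "0 < w"
    using G_transversal Y_up by (simp_all add: d_def w_def refracted_0)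
  have inner_G: "b * (p \<bullet> fst G) = d - snd G * w"
    by (simp add: d_def w_def refracted_0 inner_prod_def inner_commute)
  have unit: "b\<^sup>2 * s = 1 - w\<^sup>2"
    using refracted_unit by (simp add: w_def)
  have hp: "b * (h \<bullet> p) = d - snd G / w"
  proof -
    have "b * (h \<bullet> p) = b * (p \<bullet> fst G) - snd G / w * (b\<^sup>2 * s)"
      by (simp add: h_def s_def inner_diff_left inner_commute algebra_simps power2_eq_square)
    also have "\<dots> = d - snd G / w"
      unfolding inner_G unit using w by (simp add: field_simps power2_eq_square)
    finally show ?thesis .
  qed
  have mu2: "mat_mu2 \<kappa> 0 r p G = 1 *\<^sub>R mat 1 + ((- b / d) *\<^sub>R p) \<otimes> h"
    unfolding mat_mu2_def Let_def d_def[symmetric]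
    by (simp add: refracted_0 h_def w_def)
  have "1 + ((- b / d) *\<^sub>R p) \<bullet> h = 1 - (b * (h \<bullet> p)) / d"
    by (simp add: inner_commute)
  \<comment> \<open>Exactly the three positivity assumptions of the context make this number, hence
    \<open>mat_mu2\<close>, nondegenerate.\<close>
  also have "\<dots> = snd G / (w * d)"
    unfolding hp using d by (simp add: diff_divide_distrib)
  also have "\<dots> \<noteq> 0"
    using G_up d w by simp
  finally have inv: "invertible (mat_mu2 \<kappa> 0 r p G)"
    unfolding mu2 by (intro invertible_rank_one) auto
  \<comment> \<open>Matches the \<open>p \<otimes> p\<close> terms of the product and of
    \<open>mat_mu1\<close>; there G \<bullet> X is \<open>snd G\<close>, since X = (0, 1).\<close>
  have coeff: "- (b * \<kappa>) + (r * b / d) * (snd G / w) * b + (\<kappa> / d * b) * (b * (h \<bullet> p))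
      = - (b / d) * snd G"
    unfolding hp using d w by (simp add: divide_simps) (simp add: w_def algebra_simps)
  have "mat_mu2 \<kappa> 0 r p G ** (r *\<^sub>R mat 1 + ((- b * \<kappa>) *\<^sub>R p) \<otimes> p)
      = r *\<^sub>R mat 1 - (r * b / d) *\<^sub>R (p \<otimes> fst G)
        + (- (b * \<kappa>) + (r * b / d) * (snd G / w) * b + (\<kappa> / d * b) * (b * (h \<bullet> p))) *\<^sub>R (p \<otimes> p)"
    unfolding mu2 rank_one_mult
    by (simp add: h_def outer_diff_right algebra_simps)
  also have "\<dots> = mat_mu1 \<kappa> 0 r p G"
    unfolding mat_mu1_def Let_def d_def[symmetric] coeff
    by (simp add: refracted_0 hemi_0 inner_prod_def algebra_simps)
  finally have "matrix_inv (mat_mu2 \<kappa> 0 r p G) ** mat_mu1 \<kappa> 0 r p G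
      = r *\<^sub>R mat 1 + ((- b * \<kappa>) *\<^sub>R p) \<otimes> p"
    by (rule matrix_inv_mult_eqI[OF inv])
  then show ?thesis
    by (simp add: mat_mu0_def)
qed

lemma mat_A_0: "mat_A \<kappa> 0 r p G = r *\<^sub>R mat 1 - ((\<kappa>\<^sup>2 - 1) / r) *\<^sub>R (p \<otimes> p)"
proof -
  define c where "c = (\<kappa>\<^sup>2 - 1) / r"
  \<comment> \<open>This makes \<open>b * r - c * (q + b * s)\<close> collapse to
    \<open>- b * \<kappa> * q\<close>, cancelling the denominator \<open>q\<close> of
    \<open>mat_M\<close>.\<close>
  have c: "c * (q + b * s) = b * (\<kappa> * q + r)"
    using key_identity r by (simp add: c_def field_simps)
  have "mat_M \<kappa> 0 r p ** (r *\<^sub>R mat 1 + ((- c) *\<^sub>R p) \<otimes> p)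
      = (b * r) *\<^sub>R mat 1 + (b\<^sup>2 / q * r - b * c - b\<^sup>2 / q * c * s) *\<^sub>R (p \<otimes> p)"
    unfolding mat_M_0 rank_one_mult by (simp add: s_def algebra_simps)
  also have "b\<^sup>2 / q * r - b * c - b\<^sup>2 / q * c * s = b / q * (b * r - c * (q + b * s))"
    using q_pos by (simp add: field_simps power2_eq_square)
  also have "\<dots> = - (b * (b * \<kappa>))"
    unfolding c using q_pos by (simp add: field_simps)
  also have "(b * r) *\<^sub>R mat 1 + (- (b * (b * \<kappa>))) *\<^sub>R (p \<otimes> p) = b *\<^sub>R mat_mu0 \<kappa> 0 r p G"
    unfolding mat_mu0_0 by (simp add: algebra_simps)
  finally have "matrix_inv (mat_M \<kappa> 0 r p) ** (b *\<^sub>R mat_mu0 \<kappa> 0 r p G)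
      = r *\<^sub>R mat 1 + ((- c) *\<^sub>R p) \<otimes> p"
    by (rule matrix_inv_mult_eqI[OF invertible_mat_M])
  then show ?thesis
    by (simp add: mat_A_def matrix_mult_scaleR_right c_def flip: b_def)
qed

end

text \<open>The matrix to which the inverse of \<open>mat_M\<close> is applied is
  \<open>w *\<^sub>R mat 1 + \<alpha> *\<^sub>R (p \<otimes> p)\<close> with
  \<open>w = \<kappa> - b * r\<close>. The crux is \<open>\<alpha> * q = - (b * w)\<close>, which
  follows from \<open>key_identity\<close> and \<open>q_plus\<close>.\<close>

lemma mat_B_0: "mat_B \<kappa> 0 r p = (\<kappa> - b * r) *\<^sub>R mat 1 - (2 * b / r) *\<^sub>R (p \<otimes> p)"
proof -
  define c where "c = 2 * b / r"
  define w where "w = \<kappa> - b * r"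
  have c: "c * (q + b * s) = 2 * b * w"
    unfolding q_plus using r by (simp add: c_def w_def)
  have "\<alpha> * q * (\<kappa>\<^sup>2 - 1) = - (b * (b * (\<kappa> * q + r)))"
    using q_pos kappa_sq
    by (simp add: \<alpha>_def coef_alpha_def power2_eq_square flip: b_def q_def)
  also have "\<dots> = - (b * ((\<kappa>\<^sup>2 - 1) * w))"
  proof -
    have "b * (\<kappa> * q + r) = (\<kappa>\<^sup>2 - 1) * w"
      using key_identity r unfolding q_plus w_def by simp
    then show ?thesis
      by simp
  qed
  finally have "(\<kappa>\<^sup>2 - 1) * (\<alpha> * q) = (\<kappa>\<^sup>2 - 1) * - (b * w)"
    by (simp only: mult_ac mult_minus_right)
  then have alpha: "\<alpha> * q = - (b * w)"
    using kappa_sq by (subst (asm) mult_left_cancel) auto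
  have "mat_M \<kappa> 0 r p ** (w *\<^sub>R mat 1 + ((- c) *\<^sub>R p) \<otimes> p)
      = (b * w) *\<^sub>R mat 1 + (b\<^sup>2 / q * w - b * c - b\<^sup>2 / q * c * s) *\<^sub>R (p \<otimes> p)"
    unfolding mat_M_0 rank_one_mult by (simp add: s_def algebra_simps)
  also have "b\<^sup>2 / q * w - b * c - b\<^sup>2 / q * c * s = b / q * (b * w - c * (q + b * s))"
    using q_pos by (simp add: field_simps power2_eq_square)
  \<comment> \<open>By the choice of \<open>c\<close> the bracket is
    \<open>b * w - 2 * b * w\<close>, that is \<open>- (b * w)\<close>.\<close>
  also have "\<dots> = b / q * (\<alpha> * q)"
    unfolding c alpha by simp
  also have "\<dots> = b * \<alpha>"
    using q_pos by simp
  also have "(b * w) *\<^sub>R mat 1 + (b * \<alpha>) *\<^sub>R (p \<otimes> p) = b *\<^sub>R (w *\<^sub>R mat 1 + (\<alpha> *\<^sub>R p) \<otimes> p)"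
    by (simp add: algebra_simps)
  finally have "matrix_inv (mat_M \<kappa> 0 r p) ** (b *\<^sub>R (w *\<^sub>R mat 1 + (\<alpha> *\<^sub>R p) \<otimes> p))
      = w *\<^sub>R mat 1 + ((- c) *\<^sub>R p) \<otimes> p"
    by (rule matrix_inv_mult_eqI[OF invertible_mat_M])
  then show ?thesis
    by (simp add: mat_B_def Let_def matrix_mult_scaleR_right c_def w_def flip: b_def \<alpha>_def)
qed

end

section \<open>The determinant equation at the origin\<close>

theorem theorem2:
  fixes n1 n2 \<kappa> :: real
    and \<psi> f g :: "(real^'n) \<times> real \<Rightarrow> real"
    and \<U> \<V> :: "((real^'n) \<times> real) set"
    and \<rho> :: "real^'n \<Rightarrow> real"
    and Z :: "real^'n \<Rightarrow> (real^'n) \<times> real"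
  assumes dim: "2 \<le> CARD('n)"
    and indices: "0 < n1" "0 < n2" "\<kappa> = n1 / n2" "\<kappa> \<noteq> 1"
    and data: "refractor_data \<psi> \<U> \<V> f g"
    and C2: "Ck_on 2 (chart \<U>) \<rho>"
    and solution: "near_field_refractor \<kappa> \<U> \<V> f g \<rho> Z"
    and Y_up: "\<And>x. x \<in> chart \<U> \<Longrightarrow> 0 < snd (refracted \<kappa> x (\<rho> x) (grad \<rho> x))"
    and psi_up: "\<And>x. x \<in> chart \<U> \<Longrightarrow> 0 < snd (grad \<psi> (Z x))"
    and transversal:
      "\<And>x. x \<in> chart \<U> \<Longrightarrow> 0 < grad \<psi> (Z x) \<bullet> refracted \<kappa> x (\<rho> x) (grad \<rho> x)"
    and separated: "0 < setdist \<U> \<V>"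
    and equation:
      "\<And>x. x \<in> chart \<U> \<Longrightarrow> invertible (mat_M \<kappa> x (\<rho> x) (grad \<rho> x)) \<Longrightarrow>
         refractor_equation \<kappa> \<psi> f g \<rho> Z x"
    and origin: "0 \<in> chart \<U>"
  shows
    "let r = \<rho> 0; p = grad \<rho> 0; G = grad \<psi> (Z 0); t = stretch \<rho> Z 0;
         Y = refracted \<kappa> 0 r p; b = coef_b \<kappa> 0 r p; M = mat_M \<kappa> 0 r p
     in mat_A \<kappa> 0 r p G = r *\<^sub>R mat 1 - ((\<kappa>\<^sup>2 - 1) / r) *\<^sub>R (p \<otimes> p) \<and>
        mat_B \<kappa> 0 r p = (\<kappa> - b * r) *\<^sub>R mat 1 - (2 * b / r) *\<^sub>R (p \<otimes> p) \<and>
        det (hessian \<rho> 0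
             + (1 / (b * t)) *\<^sub>R (r *\<^sub>R mat 1 - ((\<kappa>\<^sup>2 - 1) / r) *\<^sub>R (p \<otimes> p))
             + ((\<kappa> - b * r) / b) *\<^sub>R mat 1 - (2 / r) *\<^sub>R (p \<otimes> p))
        = f (hemi 0) / (g (Z 0) * det M) * ((G \<bullet> Y) / norm G) * (1 / t ^ CARD('n)) * snd Y"
proof -
  define r where "r = \<rho> 0"
  define p where "p = grad \<rho> 0"
  define G where "G = grad \<psi> (Z 0)"
  define t where "t = stretch \<rho> Z 0"
  interpret origin_coefficients \<kappa> r p
  proof
    show "0 < \<kappa>" "\<kappa> \<noteq> 1"
      using indices by simp_all
    show "0 < r" "transmitted \<kappa> 0 r p"
      using solution origin by (simp_all add: near_field_refractor_def r_def p_def)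
  qed
  have A: "mat_A \<kappa> 0 r p G = r *\<^sub>R mat 1 - ((\<kappa>\<^sup>2 - 1) / r) *\<^sub>R (p \<otimes> p)"
    using psi_up[OF origin] transversal[OF origin] Y_up[OF origin]
    by (intro mat_A_0) (simp_all add: G_def r_def p_def)
  have B: "(1 / b) *\<^sub>R mat_B \<kappa> 0 r p = ((\<kappa> - b * r) / b) *\<^sub>R mat 1 - (2 / r) *\<^sub>R (p \<otimes> p)"
    unfolding mat_B_0 using b_nonzero by (simp add: scaleR_diff_right)
  have det_M: "det (mat_M \<kappa> 0 r p) \<noteq> 0"
    using invertible_mat_M by (simp add: invertible_det_nz)
  \<comment> \<open>Division by the determinant of \<open>mat_M\<close>; the factor
    \<open>y / 1\<close> is y_{n+1} / x_{n+1}, with x_{n+1} = 1 at the origin.\<close>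
  have divide_det: "D = F / (g' * det (mat_M \<kappa> 0 r p)) * u * v * y"
    if "det (mat_M \<kappa> 0 r p) * D = F / g' * (y / 1) * u * v" for D F g' u v y
  proof -
    have "D = F / g' * (y / 1) * u * v / det (mat_M \<kappa> 0 r p)"
      using that det_M by (metis nonzero_mult_div_cancel_left)
    then show ?thesis
      by (simp add: mult_ac)
  qed
  \<comment> \<open>The equation is assumed only where \<open>mat_M\<close> is invertible, which was
    proved at the origin.\<close>
  have "refractor_equation \<kappa> \<psi> f g \<rho> Z 0"
    using equation[OF origin] invertible_mat_M by (simp add: r_def p_def)
  then have "det (mat_M \<kappa> 0 r p) *
      det (hessian \<rho> 0 + (1 / (b * t)) *\<^sub>R mat_A \<kappa> 0 r p G + (1 / b) *\<^sub>R mat_B \<kappa> 0 r p)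
    = f (hemi 0) / g (Z 0) * (snd (refracted \<kappa> 0 r p) / 1)
      * ((G \<bullet> refracted \<kappa> 0 r p) / norm G) * (1 / t ^ CARD('n))"
    unfolding refractor_equation_def Let_def r_def[symmetric] p_def[symmetric] G_def[symmetric]
      t_def[symmetric] b_def[symmetric] by (simp add: hemi_0)
  then have "det (hessian \<rho> 0
        + (1 / (b * t)) *\<^sub>R (r *\<^sub>R mat 1 - ((\<kappa>\<^sup>2 - 1) / r) *\<^sub>R (p \<otimes> p))
        + ((\<kappa> - b * r) / b) *\<^sub>R mat 1 - (2 / r) *\<^sub>R (p \<otimes> p))
    = f (hemi 0) / (g (Z 0) * det (mat_M \<kappa> 0 r p))
      * ((G \<bullet> refracted \<kappa> 0 r p) / norm G) * (1 / t ^ CARD('n)) * snd (refracted \<kappa> 0 r p)"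
    unfolding A B add_diff_eq by (rule divide_det)
  then show ?thesis
    unfolding Let_def r_def[symmetric] p_def[symmetric] G_def[symmetric]
      t_def[symmetric] b_def[symmetric] using A mat_B_0 by blast
qed

end
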